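(* For every conflict-free event structure $(E,\mathrm{en})$, the family of configurations $\mathcal F(E)$ is a diamond-free semimodular lattice. Furthermore, if $(E,\mathrm{dep})$ is a preDSC, then there exist a DSC $(\widetilde E,\widetilde{\mathrm{dep}})$ and an isomorphism $\mathsf{rdp}(E)\cong\mathsf{rdp}(\widetilde E)$.
   Context: $P(A)$ denotes the power set of $A$. Event structures. A conflict-free event structure (CFES) is a pair $(E,\mathrm{en})$ with $E$ a finite set and $\mathrm{en}:E\to P(P(E))$ such that $X\in\mathrm{en}(e)$ and $X\subseteq Y\subseteq E$ imply $Y\in\mathrm{en}(e)$. A configuration is a subset $X\subseteq E$ such that for every $e\in X$ there is a finite sequence $e_0,\dots,e_n\in X$ with $e_n=e$ and $\{e_0,\dots,e_{i-1}\}\in\mathrm{en}(e_i)$ for all $0\le i\le n$ (for $i=0$ this set is empty). $\mathcal F(E)$ is the poset of configurations ordered by inclusion. DSCs. A preDSC is a pair $(E,\mathrm{dep})$ with $E$ a finite set and $\mathrm{dep}:E\to P(P(E))$ a function; elements of $\mathrm{dep}(e)$ are called depsets of $e$. For $X,Y\subseteq E$ write $X\,\mathrm{rch}\,Y$ if $X\subseteq Y$ and for every $y\in Y$ there is $D\in\mathrm{dep}(y)$ with $D\subseteq X$. A subset $X\subseteq E$ is reachable if there is a finite sequence of subsets with $\varnothing\,\mathrm{rch}\,X_0\,\mathrm{rch}\cdots\mathrm{rch}\,X_n\,\mathrm{rch}\,X$. $\mathsf{rdp}(E)$ is the poset of reachable subsets ordered by inclusion. A subset $X$ is complete if every $e\in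 X$ has a depset $D\in\mathrm{dep}(e)$ with $D\subseteq X$. A DSC is a preDSC which is irredundant ($D_0\subseteq D_1$ with $D_0,D_1\in\mathrm{dep}(e)$ implies $D_0=D_1$), acyclic ($e\notin D$ for all $D\in\mathrm{dep}(e)$), nonsingular ($\mathrm{dep}(e)\neq\varnothing$ for all $e$) and has complete depsets (all $D\in\mathrm{dep}(e)$ are complete). Lattices. $x\prec y$ means $x<y$ and there is no $z$ with $x<z<y$. A lattice is (upper) semimodular if $a\wedge b\prec a$ implies $b\prec a\vee b$. It is diamond-free semimodular if it is semimodular and has no sublattice (subset closed under binary meets and joins) isomorphic to $M_3=\{\bot,a,b,c,\top\}$, in which $a,b,c$ are pairwise incomparable, each strictly between $\bot$ and $\top$. *)

theory Defs
  imports "HOL-Algebra.Lattice"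
begin

section \<open>Posets and lattices\<close>

definition inclusion_order :: "'a set set \<Rightarrow> 'a set gorder" where
  "inclusion_order F = \<lparr>carrier = F, eq = (=), le = (\<subseteq>)\<rparr>"

definition order_isomorphic :: "('a, 'c) gorder_scheme \<Rightarrow> ('b, 'd) gorder_scheme \<Rightarrow> bool" where
  "order_isomorphic L M \<longleftrightarrow>
     (\<exists>f. bij_betw f (carrier L) (carrier M) \<and>
          (\<forall>x\<in>carrier L. \<forall>y\<in>carrier L. x \<sqsubseteq>\<^bsub>L\<^esub> y \<longleftrightarrow> f x \<sqsubseteq>\<^bsub>M\<^esub> f y))"

definition covered_by :: "('a, 'c) gorder_scheme \<Rightarrow> 'a \<Rightarrow> 'a \<Rightarrow> bool" where
  "covered_by L x y \<longleftrightarrow>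
     x \<in> carrier L \<and> y \<in> carrier L \<and> x \<sqsubset>\<^bsub>L\<^esub> y \<and>
     \<not> (\<exists>z\<in>carrier L. x \<sqsubset>\<^bsub>L\<^esub> z \<and> z \<sqsubset>\<^bsub>L\<^esub> y)"

definition sublattice :: "'a set \<Rightarrow> ('a, 'c) gorder_scheme \<Rightarrow> bool" where
  "sublattice S L \<longleftrightarrow>
     S \<subseteq> carrier L \<and> (\<forall>x\<in>S. \<forall>y\<in>S. x \<sqinter>\<^bsub>L\<^esub> y \<in> S \<and> x \<squnion>\<^bsub>L\<^esub> y \<in> S)"

datatype diamond = Diamond_bot | Diamond_a | Diamond_b | Diamond_c | Diamond_top

definition M3 :: "diamond gorder" where
  "M3 = \<lparr>carrier = UNIV, eq = (=),
         le = (\<lambda>x y. x = y \<or> x = Diamond_bot \<or> y = Diamond_top)\<rparr>"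

locale semimodular_lattice = lattice +
  assumes semimodular:
    "\<lbrakk>a \<in> carrier L; b \<in> carrier L; covered_by L (a \<sqinter> b) a\<rbrakk> \<Longrightarrow> covered_by L b (a \<squnion> b)"

text \<open>
  The order induced on a sublattice determines its meets and joins, so comparing it with
  \<^const>\<open>M3\<close> as a poset is the same as comparing it as a lattice.
\<close>

locale diamond_free_semimodular_lattice = semimodular_lattice +
  assumes diamond_free:
    "\<not> (\<exists>S. sublattice S L \<and> order_isomorphic (L\<lparr>carrier := S\<rparr>) M3)"


section \<open>Conflict-free event structures\<close>

text \<open>
  Throughout, functions \<open>en\<close>, \<open>dep\<close> on a set \<open>E\<close> are total HOL functions of which only
  the values on \<open>E\<close> matter.
\<close>

locale CFES =
  fixes E :: "'a set" and en :: "'a \<Rightarrow> 'a set set"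
  assumes finite_events: "finite E"
    and en_subsets: "e \<in> E \<Longrightarrow> en e \<subseteq> Pow E"
    and en_upward: "\<lbrakk>e \<in> E; X \<in> en e; X \<subseteq> Y; Y \<subseteq> E\<rbrakk> \<Longrightarrow> Y \<in> en e"

definition configuration :: "'a set \<Rightarrow> ('a \<Rightarrow> 'a set set) \<Rightarrow> 'a set \<Rightarrow> bool" where
  "configuration E en X \<longleftrightarrow>
     X \<subseteq> E \<and>
     (\<forall>e\<in>X. \<exists>(n::nat) (s::nat \<Rightarrow> 'a).
        (\<forall>i\<le>n. s i \<in> X) \<and> s n = e \<and> (\<forall>i\<le>n. s ` {..<i} \<in> en (s i)))"

definition configuration_poset :: "'a set \<Rightarrow> ('a \<Rightarrow> 'a set set) \<Rightarrow> 'a set gorder" where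
  "configuration_poset E en = inclusion_order {X. configuration E en X}"


section \<open>DSCs\<close>

locale preDSC =
  fixes E :: "'a set" and dep :: "'a \<Rightarrow> 'a set set"
  assumes finite_events: "finite E"
    and dep_subsets: "e \<in> E \<Longrightarrow> dep e \<subseteq> Pow E"

definition rch :: "'a set \<Rightarrow> ('a \<Rightarrow> 'a set set) \<Rightarrow> 'a set \<Rightarrow> 'a set \<Rightarrow> bool" where
  "rch E dep X Y \<longleftrightarrow> X \<subseteq> E \<and> Y \<subseteq> E \<and> X \<subseteq> Y \<and> (\<forall>y\<in>Y. \<exists>D\<in>dep y. D \<subseteq> X)"

definition reachable :: "'a set \<Rightarrow> ('a \<Rightarrow> 'a set set) \<Rightarrow> 'a set \<Rightarrow> bool" where
  "reachable E dep X \<longleftrightarrow>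
     X \<subseteq> E \<and>
     (\<exists>(n::nat) (s::nat \<Rightarrow> 'a set).
        rch E dep {} (s 0) \<and> (\<forall>i<n. rch E dep (s i) (s (Suc i))) \<and> rch E dep (s n) X)"

definition rdp :: "'a set \<Rightarrow> ('a \<Rightarrow> 'a set set) \<Rightarrow> 'a set gorder" where
  "rdp E dep = inclusion_order {X. reachable E dep X}"

definition complete :: "('a \<Rightarrow> 'a set set) \<Rightarrow> 'a set \<Rightarrow> bool" where
  "complete dep X \<longleftrightarrow> (\<forall>e\<in>X. \<exists>D\<in>dep e. D \<subseteq> X)"

locale DSC = preDSC +
  assumes irredundant:
      "\<lbrakk>e \<in> E; D\<^sub>0 \<in> dep e; D\<^sub>1 \<in> dep e; D\<^sub>0 \<subseteq> D\<^sub>1\<rbrakk> \<Longrightarrow> D\<^sub>0 = D\<^sub>1"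
    and acyclic: "\<lbrakk>e \<in> E; D \<in> dep e\<rbrakk> \<Longrightarrow> e \<notin> D"
    and nonsingular: "e \<in> E \<Longrightarrow> dep e \<noteq> {}"
    and complete_depsets: "\<lbrakk>e \<in> E; D \<in> dep e\<rbrakk> \<Longrightarrow> complete dep D"

end

theory Submission
  imports Defs
begin

text \<open>
  Both halves reduce to one observation: configurations of a conflict-free event structure, and
  reachable subsets of a preDSC, are exactly the sets that can be built from \<open>{}\<close> by adding
  events one at a time, each enabled by what is already present. Enabling is monotone, so such
  sets are closed under union, and they form an antimatroid.

  In an antimatroid \<open>F\<close>, a feasible set properly contained in another one can be enlarged
  inside it by a single element (\<open>augmentation\<close>). Hence the covers in the
  inclusion order are exactly the one-element extensions, and semimodularity says
  only that adding a fixed element stays feasible after taking a union with \<open>b\<close>. If \<open>z, a, b, c, t\<close>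
  were a diamond, augmentation would give \<open>y \<in> a - z\<close> with \<open>insert y z\<close> feasible. Since
  joins are unions, \<open>y \<in> t = b \<union> c\<close>, say \<open>y \<in> b\<close>; then \<open>insert y z\<close> lies
  below \<open>a\<close> and \<open>b\<close>, hence below their meet \<open>z\<close>, which is absurd.

  For the second half, replace the depsets of \<open>e\<close> by the minimal feasible sets \<open>D\<close> to
  which \<open>e\<close> can be added as a new element, and discard the events that lie in no feasible set. Minimality
  gives irredundancy, novelty of \<open>e\<close> gives acyclicity, and looking at the moment an element \<open>e\<close>
  of a feasible set is added (\<open>feasible_before\<close>) gives a depset of \<open>e\<close> inside that set, hence
  nonsingularity and complete depsets. The new DSC has literally the same reachable sets as the
  old preDSC, so the isomorphism is the identity.
\<close>

section \<open>Lattices of sets ordered by inclusion\<close>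

lemma inclusion_order_simps [simp]:
  "carrier (inclusion_order F) = F"
  "x \<sqsubseteq>\<^bsub>inclusion_order F\<^esub> y \<longleftrightarrow> x \<subseteq> y"
  "x .=\<^bsub>inclusion_order F\<^esub> y \<longleftrightarrow> x = y"
  "x \<sqsubset>\<^bsub>inclusion_order F\<^esub> y \<longleftrightarrow> x \<subset> y"
  by (auto simp: inclusion_order_def lless_def)

lemma partial_order_inclusion_order: "partial_order (inclusion_order F)"
  by unfold_locales (auto simp: inclusion_order_def)

section \<open>Antimatroids\<close>

locale antimatroid =
  fixes F :: "'a set set"
  assumes finite_ground: "finite (\<Union>F)"
    and empty_feasible: "{} \<in> F"
    and Un_feasible: "\<lbrakk>X \<in> F; Y \<in> F\<rbrakk> \<Longrightarrow> X \<union> Y \<in> F"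
    and accessible: "\<lbrakk>X \<in> F; X \<noteq> {}\<rbrakk> \<Longrightarrow> \<exists>x\<in>X. X - {x} \<in> F"
begin

lemma finite_feasible: "X \<in> F \<Longrightarrow> finite X"
  using finite_ground by (meson Sup_upper finite_subset)

lemma finite_family: "finite F"
  using finite_ground by (rule finite_UnionD)

lemma Union_feasible: "G \<subseteq> F \<Longrightarrow> \<Union>G \<in> F"
proof -
  assume "G \<subseteq> F"
  then have "finite G" using finite_family finite_subset by blast
  then show ?thesis using \<open>G \<subseteq> F\<close>
    by (induction G rule: finite_induct) (auto simp: empty_feasible Un_feasible)
qed

text \<open>
  Dismantle \<open>Y\<close> one element at a time: the first moment at which the remainder lies
  in \<open>X\<close>, the element just removed is the one sought.
\<close>

lemma augmentation:
  assumes "X \<in> F" "Y \<in> F" "\<not> Y \<subseteq> X"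
  shows "\<exists>y\<in>Y - X. insert y X \<in> F"
  using assms(2,3)
proof (induction "card Y" arbitrary: Y rule: less_induct)
  case less
  then obtain x where x: "x \<in> Y" "Y - {x} \<in> F"
    using accessible by blast
  show ?case
  proof (cases "Y - {x} \<subseteq> X")
    case True
    then have "insert x X = X \<union> Y" "x \<in> Y - X"
      using less.prems(2) x(1) by auto
    then show ?thesis
      using Un_feasible[OF assms(1) less.prems(1)] by (intro bexI[of _ x]) simp_all
  next
    case False
    have "card (Y - {x}) < card Y"
      using x(1) finite_feasible[OF less.prems(1)] by (rule card_Diff1_less[rotated])
    from less.hyps[OF this x(2) False] show ?thesis by blast
  qed
qed

text \<open>
  The set \<open>Y\<close> records what is present at a moment at which \<open>x\<close> can be added: a maximal
  feasible subset avoiding \<open>x\<close> can only be augmented by \<open>x\<close> itself.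
\<close>

lemma feasible_before:
  assumes "X \<in> F" "x \<in> X"
  shows "\<exists>Y\<in>F. Y \<subseteq> X \<and> x \<notin> Y \<and> insert x Y \<in> F"
proof -
  define S where "S = {Y \<in> F. Y \<subseteq> X \<and> x \<notin> Y}"
  have "finite S" "S \<noteq> {}"
    using finite_family empty_feasible unfolding S_def by auto
  from finite_has_maximal[OF this]
  obtain Y where Y: "Y \<in> S" and max: "\<forall>Z\<in>S. Y \<subseteq> Z \<longrightarrow> Y = Z"
    by (rule bexE)
  obtain y where y: "y \<in> X - Y" "insert y Y \<in> F"
    using augmentation[of Y X] Y assms unfolding S_def by blast
  have "y = x"
  proof (rule ccontr)
    assume "y \<noteq> x"
    then have "insert y Y \<in> S" using Y y by (simp add: S_def)
    with max y(1) show False by blast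
  qed
  with Y y show ?thesis by (auto simp: S_def)
qed

subsection \<open>The lattice of feasible sets\<close>

text \<open>
  Meets are not intersections: they are the largest feasible subsets of intersections.
\<close>

lemma lattice_inclusion_order: "lattice (inclusion_order F)"
proof -
  interpret partial_order "inclusion_order F"
    by (rule partial_order_inclusion_order)
  show ?thesis
  proof unfold_locales
    fix x y assume "x \<in> carrier (inclusion_order F)" "y \<in> carrier (inclusion_order F)"
    then have xy: "x \<in> F" "y \<in> F" by simp_all
    show "\<exists>s. least (inclusion_order F) s (Upper (inclusion_order F) {x, y})"
      by (rule exI[of _ "x \<union> y"]) (use xy Un_feasible in \<open>auto simp: least_def Upper_def\<close>)
    have "\<Union>{Z \<in> F. Z \<subseteq> x \<and> Z \<subseteq> y} \<in> F"
      by (rule Union_feasible) auto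
    then show "\<exists>s. greatest (inclusion_order F) s (Lower (inclusion_order F) {x, y})"
      by (intro exI[of _ "\<Union>{Z \<in> F. Z \<subseteq> x \<and> Z \<subseteq> y}"])
        (use xy in \<open>auto simp: greatest_def Lower_def\<close>)
  qed
qed

lemma join_eq_Un:
  assumes "X \<in> F" "Y \<in> F"
  shows "X \<squnion>\<^bsub>inclusion_order F\<^esub> Y = X \<union> Y"
proof -
  interpret lattice "inclusion_order F" by (rule lattice_inclusion_order)
  show ?thesis
  proof
    show "X \<squnion>\<^bsub>inclusion_order F\<^esub> Y \<subseteq> X \<union> Y"
      using join_le[of X "X \<union> Y" Y] assms Un_feasible[OF assms] by simp
    show "X \<union> Y \<subseteq> X \<squnion>\<^bsub>inclusion_order F\<^esub> Y"
      using join_left[of X Y] join_right[of X Y] assms by simp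
  qed
qed

lemma meet_feasible:
  assumes "X \<in> F" "Y \<in> F"
  shows "X \<sqinter>\<^bsub>inclusion_order F\<^esub> Y \<in> F"
    and "X \<sqinter>\<^bsub>inclusion_order F\<^esub> Y \<subseteq> X \<inter> Y"
    and "\<lbrakk>Z \<in> F; Z \<subseteq> X; Z \<subseteq> Y\<rbrakk> \<Longrightarrow> Z \<subseteq> X \<sqinter>\<^bsub>inclusion_order F\<^esub> Y"
proof -
  interpret lattice "inclusion_order F" by (rule lattice_inclusion_order)
  show "X \<sqinter>\<^bsub>inclusion_order F\<^esub> Y \<in> F"
    using meet_closed[of X Y] assms by simp
  show "X \<sqinter>\<^bsub>inclusion_order F\<^esub> Y \<subseteq> X \<inter> Y"
    using meet_left[of X Y] meet_right[of X Y] assms by simp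
  show "\<lbrakk>Z \<in> F; Z \<subseteq> X; Z \<subseteq> Y\<rbrakk> \<Longrightarrow> Z \<subseteq> X \<sqinter>\<^bsub>inclusion_order F\<^esub> Y"
    using meet_le[of Z X Y] assms by simp
qed

lemma covered_by_iff_insert:
  "covered_by (inclusion_order F) X Y \<longleftrightarrow> X \<in> F \<and> Y \<in> F \<and> (\<exists>y. y \<notin> X \<and> Y = insert y X)"
proof
  assume cov: "covered_by (inclusion_order F) X Y"
  then have XY: "X \<in> F" "Y \<in> F" "X \<subset> Y"
    and no_between: "\<And>Z. Z \<in> F \<Longrightarrow> X \<subset> Z \<Longrightarrow> \<not> Z \<subset> Y"
    by (auto simp: covered_by_def)
  then obtain y where y: "y \<in> Y - X" "insert y X \<in> F"
    using augmentation[of X Y] by blast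
  have "Y = insert y X"
    using no_between[OF y(2)] y XY(3) by blast
  with XY y show "X \<in> F \<and> Y \<in> F \<and> (\<exists>y. y \<notin> X \<and> Y = insert y X)" by blast
next
  assume "X \<in> F \<and> Y \<in> F \<and> (\<exists>y. y \<notin> X \<and> Y = insert y X)"
  then show "covered_by (inclusion_order F) X Y"
    by (auto simp: covered_by_def)
qed

lemma no_diamond:
  assumes feasible: "z \<in> F" "a \<in> F" "b \<in> F" "c \<in> F"
    and "\<not> a \<subseteq> z" "z \<subseteq> b" "z \<subseteq> c" "z \<subseteq> a"
    and meets: "a \<sqinter>\<^bsub>inclusion_order F\<^esub> b \<subseteq> z" "a \<sqinter>\<^bsub>inclusion_order F\<^esub> c \<subseteq> z"
    and join: "a \<subseteq> b \<squnion>\<^bsub>inclusion_order F\<^esub> c"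
  shows False
proof -
  obtain y where y: "y \<in> a" "y \<notin> z" "insert y z \<in> F"
    using augmentation[OF feasible(1,2)] assms(5) by auto
  consider "y \<in> b" | "y \<in> c"
    using join join_eq_Un[OF feasible(3,4)] y(1) by auto
  then show False
  proof cases
    case 1
    then show False
      using meet_feasible(3)[OF feasible(2,3) y(3)] meets(1) y assms(6,8) by auto
  next
    case 2
    then show False
      using meet_feasible(3)[OF feasible(2,4) y(3)] meets(2) y assms(7,8) by auto
  qed
qed

theorem diamond_free_semimodular_lattice:
  "diamond_free_semimodular_lattice (inclusion_order F)"
proof -
  let ?L = "inclusion_order F"
  interpret lattice ?L by (rule lattice_inclusion_order)
  show ?thesis
  proof unfold_locales
    fix a b assume "a \<in> carrier ?L" "b \<in> carrier ?L"
      and cov: "covered_by ?L (a \<sqinter>\<^bsub>?L\<^esub> b) a"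
    then have ab: "a \<in> F" "b \<in> F" by simp_all
    obtain y where y: "y \<notin> a \<sqinter>\<^bsub>?L\<^esub> b" "a = insert y (a \<sqinter>\<^bsub>?L\<^esub> b)"
      using cov by (auto simp: covered_by_iff_insert)
    have "y \<notin> b"
    proof
      assume "y \<in> b"
      then have "a \<subseteq> b"
        by (subst y(2)) (use meet_feasible(2)[OF ab] in blast)
      then show False using meet_feasible(3)[OF ab ab(1)] y by blast
    qed
    moreover have "a \<union> b = insert y b"
      by (subst y(2)) (use meet_feasible(2)[OF ab] in blast)
    ultimately show "covered_by ?L b (a \<squnion>\<^bsub>?L\<^esub> b)"
      using ab Un_feasible[OF ab] by (auto simp: covered_by_iff_insert join_eq_Un)
  next
    show "\<not> (\<exists>S. sublattice S ?L \<and> order_isomorphic (?L\<lparr>carrier := S\<rparr>) M3)"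
    proof
      assume "\<exists>S. sublattice S ?L \<and> order_isomorphic (?L\<lparr>carrier := S\<rparr>) M3"
      then obtain S f where S: "sublattice S ?L" and bij: "bij_betw f S UNIV"
        and le: "\<And>x y. x \<in> S \<Longrightarrow> y \<in> S \<Longrightarrow>
          x \<subseteq> y \<longleftrightarrow> f x = f y \<or> f x = Diamond_bot \<or> f y = Diamond_top"
        by (auto simp: order_isomorphic_def M3_def inclusion_order_def)
      have SF: "S \<subseteq> F" and closed: "\<And>x y. x \<in> S \<Longrightarrow> y \<in> S \<Longrightarrow> x \<sqinter>\<^bsub>?L\<^esub> y \<in> S"
          "\<And>x y. x \<in> S \<Longrightarrow> y \<in> S \<Longrightarrow> x \<squnion>\<^bsub>?L\<^esub> y \<in> S"
        using S by (auto simp: sublattice_def)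
      have "\<exists>x\<in>S. f x = d" for d
        using bij by (metis UNIV_I bij_betw_imp_surj_on imageE)
      then obtain z a b c where el: "z \<in> S" "a \<in> S" "b \<in> S" "c \<in> S"
        and im: "f z = Diamond_bot" "f a = Diamond_a" "f b = Diamond_b" "f c = Diamond_c"
        by metis
      \<comment> \<open>Meets and joins are taken in the whole lattice, but they lie in \<open>S\<close>, where the
         order of the diamond leaves only one candidate for each.\<close>
      have below: "x \<subseteq> z" if "x \<in> S" "x \<subseteq> a" "x \<subseteq> b \<or> x \<subseteq> c" for x
        using that le[of x a] le[of x b] le[of x c] le[of x z] el im by auto
      have above: "a \<subseteq> x" if "x \<in> S" "b \<subseteq> x" "c \<subseteq> x" for x
        using that le[of b x] le[of c x] le[of a x] el im by auto
      have F: "z \<in> F" "a \<in> F" "b \<in> F" "c \<in> F" using SF el by auto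
      show False
      proof (rule no_diamond[OF F])
        show "\<not> a \<subseteq> z" "z \<subseteq> b" "z \<subseteq> c" "z \<subseteq> a"
          using le el im by auto
        show "a \<sqinter>\<^bsub>?L\<^esub> b \<subseteq> z"
          using below[OF closed(1)] el meet_feasible(2)[OF F(2,3)] by blast
        show "a \<sqinter>\<^bsub>?L\<^esub> c \<subseteq> z"
          using below[OF closed(1)] el meet_feasible(2)[OF F(2,4)] by blast
        show "a \<subseteq> b \<squnion>\<^bsub>?L\<^esub> c"
          using above[OF closed(2)] el join_eq_Un[OF F(3,4)] by blast
      qed
    qed
  qed
qed

end

section \<open>Sets built by adding enabled events\<close>

inductive secured :: "'a set \<Rightarrow> ('a \<Rightarrow> 'a set set) \<Rightarrow> 'a set \<Rightarrow> bool" for E en where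
  empty: "secured E en {}"
| insert: "\<lbrakk>secured E en X; e \<in> E; X \<in> en e\<rbrakk> \<Longrightarrow> secured E en (insert e X)"

lemma secured_subset: "secured E en X \<Longrightarrow> X \<subseteq> E"
  by (induction rule: secured.induct) auto

lemma secured_accessible:
  "\<lbrakk>secured E en X; X \<noteq> {}\<rbrakk> \<Longrightarrow> \<exists>x\<in>X. secured E en (X - {x})"
proof (induction rule: secured.induct)
  case (insert X e)
  show ?case
  proof (cases "e \<in> X")
    case True
    then show ?thesis using insert by (auto simp: insert_absorb)
  next
    case False
    then show ?thesis using insert by auto
  qed
qed simp

lemma secured_iff_sequence:
  "secured E en X \<longleftrightarrow>
     (\<exists>n s. X = s ` {..<n::nat} \<and> (\<forall>i<n. s i \<in> E \<and> s ` {..<i} \<in> en (s i)))"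
proof
  assume "secured E en X"
  then show "\<exists>n s. X = s ` {..<n::nat} \<and> (\<forall>i<n. s i \<in> E \<and> s ` {..<i} \<in> en (s i))"
  proof (induction rule: secured.induct)
    case empty
    show ?case by (rule exI[of _ 0]) simp
  next
    case (insert X e)
    then obtain n s where s: "X = s ` {..<n::nat}" "\<forall>i<n. s i \<in> E \<and> s ` {..<i} \<in> en (s i)"
      by blast
    define t where "t = s(n := e)"
    have t: "t n = e" "\<And>i. i < n \<Longrightarrow> t i = s i"
      by (auto simp: t_def)
    then have img: "t ` {..<i} = s ` {..<i}" if "i \<le> n" for i
      using that by (intro image_cong) auto
    show ?case
    proof (intro exI conjI)
      show "insert e X = t ` {..<Suc n}"
        using s(1) img[of n] t(1) by (simp add: lessThan_Suc)
      show "\<forall>i<Suc n. t i \<in> E \<and> t ` {..<i} \<in> en (t i)"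
        using s insert.hyps img t by (auto simp: less_Suc_eq)
    qed
  qed
next
  assume "\<exists>n s. X = s ` {..<n::nat} \<and> (\<forall>i<n. s i \<in> E \<and> s ` {..<i} \<in> en (s i))"
  then obtain n s where X: "X = s ` {..<n::nat}"
    and s: "\<forall>i<n. s i \<in> E \<and> s ` {..<i} \<in> en (s i)" by blast
  have "secured E en (s ` {..<k})" if "k \<le> n" for k
    using that
  proof (induction k)
    case (Suc k)
    then show ?case
      using secured.insert[of E en "s ` {..<k}" "s k"] s by (simp add: lessThan_Suc)
  qed (simp add: secured.empty)
  then show "secured E en X" using X by simp
qed

context CFES
begin

lemma secured_Un:
  assumes "secured E en X" "secured E en Y"
  shows "secured E en (X \<union> Y)"
  using assms(2)
proof (induction rule: secured.induct)
  case (insert Y e)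
  note IH = insert.IH
  have "X \<union> Y \<in> en e"
    using en_upward[OF insert.hyps(2,3)] secured_subset[OF IH] by blast
  from secured.insert[OF IH insert.hyps(2) this] show ?case by simp
qed (use assms(1) in simp)

lemma antimatroid_secured: "antimatroid {X. secured E en X}"
proof
  have "\<Union>{X. secured E en X} \<subseteq> E" using secured_subset by blast
  then show "finite (\<Union>{X. secured E en X})" using finite_events finite_subset by blast
qed (auto intro: secured.empty secured_Un dest: secured_accessible)

text \<open>
  Each element of a configuration has its own securing sequence; the configuration is the
  union of these sequences, and closure under union merges them into a single one.
\<close>

lemma configuration_iff_secured: "configuration E en X \<longleftrightarrow> secured E en X"
proof
  assume conf: "configuration E en X"
  then have XE: "X \<subseteq> E" by (simp add: configuration_def)
  interpret antimatroid "{X. secured E en X}" by (rule antimatroid_secured)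
  have "\<exists>Y. secured E en Y \<and> e \<in> Y \<and> Y \<subseteq> X" if e: "e \<in> X" for e
  proof -
    obtain n and s :: "nat \<Rightarrow> 'a" where s: "\<forall>i\<le>n. s i \<in> X" "s n = e" "\<forall>i\<le>n. s ` {..<i} \<in> en (s i)"
      using conf e unfolding configuration_def by blast
    have "secured E en (s ` {..<Suc n})"
      unfolding secured_iff_sequence using s XE
      by (intro exI[of _ "Suc n"] exI[of _ s]) (auto simp: less_Suc_eq_le)
    moreover have "e \<in> s ` {..<Suc n}" "s ` {..<Suc n} \<subseteq> X"
      using s by (auto simp: less_Suc_eq_le)
    ultimately show ?thesis by blast
  qed
  then have "X = \<Union>{Y. secured E en Y \<and> Y \<subseteq> X}" by blast
  moreover have "\<Union>{Y. secured E en Y \<and> Y \<subseteq> X} \<in> {X. secured E en X}"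
    by (rule Union_feasible) auto
  ultimately show "secured E en X" by simp
next
  assume sec: "secured E en X"
  then obtain n and s :: "nat \<Rightarrow> 'a" where X: "X = s ` {..<n}"
    and s: "\<forall>i<n. s i \<in> E \<and> s ` {..<i} \<in> en (s i)"
    unfolding secured_iff_sequence by blast
  have "\<exists>(m::nat) t. (\<forall>i\<le>m. t i \<in> X) \<and> t m = e \<and> (\<forall>i\<le>m. t ` {..<i} \<in> en (t i))" if e: "e \<in> X" for e
  proof -
    obtain k where "k < n" "e = s k" using e X by auto
    then show ?thesis using X s by (intro exI[of _ k] exI[of _ s]) auto
  qed
  then show "configuration E en X"
    using secured_subset[OF sec] by (auto simp: configuration_def)
qed

end

section \<open>Reachable sets of a preDSC\<close>

definition enabled_by_depsets :: "'a set \<Rightarrow> ('a \<Rightarrow> 'a set set) \<Rightarrow> 'a \<Rightarrow> 'a set set" where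
  "enabled_by_depsets E dep e = {X. X \<subseteq> E \<and> (\<exists>D\<in>dep e. D \<subseteq> X)}"

lemma CFES_enabled_by_depsets: "finite E \<Longrightarrow> CFES E (enabled_by_depsets E dep)"
  by (unfold_locales, auto simp: enabled_by_depsets_def, meson order_trans)

text \<open>
  A step of \<open>rch\<close> may add many events at once. All of them are enabled already by the
  smaller set, so they may as well be added one after another.
\<close>

lemma secured_rch:
  assumes "finite E" "rch E dep X Y" "secured E (enabled_by_depsets E dep) X"
  shows "secured E (enabled_by_depsets E dep) Y"
proof -
  have finY: "finite Y" using assms(1,2) by (auto simp: rch_def intro: finite_subset)
  have "secured E (enabled_by_depsets E dep) (X \<union> Z)" if "Z \<subseteq> Y" for Z
    using finite_subset[OF that finY] that
  proof (induction Z rule: finite_induct)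
    case (insert z Z)
    then have IH: "secured E (enabled_by_depsets E dep) (X \<union> Z)" by simp
    obtain D where "D \<in> dep z" "D \<subseteq> X" and zE: "z \<in> E"
      using insert.prems assms(2) unfolding rch_def by blast
    then have "X \<union> Z \<in> enabled_by_depsets E dep z"
      using secured_subset[OF IH] unfolding enabled_by_depsets_def by blast
    from secured.insert[OF IH zE this] show ?case by simp
  qed (use assms(3) in simp)
  from this[of Y] show ?thesis using assms(2) by (simp add: rch_def Un_absorb1)
qed

text \<open>
  Conversely, adding one enabled event is a step of \<open>rch\<close> because a reachable set is complete: the
  events already present keep depsets inside it.
\<close>

lemma reachable_insert:
  assumes "reachable E dep X" "e \<in> E" "D \<in> dep e" "D \<subseteq> X"
  shows "reachable E dep (insert e X)"
proof -
  obtain n s where s: "rch E dep {} (s (0::nat))" "\<forall>i<n. rch E dep (s i) (s (Suc i))"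
      "rch E dep (s n) X"
    using assms(1) unfolding reachable_def by blast
  have step: "rch E dep X (insert e X)"
    using s(3) assms(2-4) unfolding rch_def by blast
  let ?s = "s(Suc n := X)"
  have "rch E dep {} (?s 0)" "\<forall>i<Suc n. rch E dep (?s i) (?s (Suc i))"
      "rch E dep (?s (Suc n)) (insert e X)"
    using s step by (auto simp: less_Suc_eq)
  then show ?thesis
    using step unfolding reachable_def rch_def[of E dep X] by blast
qed

lemma reachable_iff_secured:
  assumes "finite E"
  shows "reachable E dep X \<longleftrightarrow> secured E (enabled_by_depsets E dep) X"
proof
  assume "reachable E dep X"
  then obtain n s where s: "rch E dep {} (s (0::nat))" "\<forall>i<n. rch E dep (s i) (s (Suc i))"
      "rch E dep (s n) X"
    unfolding reachable_def by blast
  have "secured E (enabled_by_depsets E dep) (s i)" if "i \<le> n" for i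
    using that
  proof (induction i)
    case 0
    show ?case by (rule secured_rch[OF assms s(1) secured.empty])
  next
    case (Suc i)
    then show ?case using secured_rch[OF assms, of dep "s i" "s (Suc i)"] s(2) by simp
  qed
  then show "secured E (enabled_by_depsets E dep) X"
    using secured_rch[OF assms s(3)] by blast
next
  assume "secured E (enabled_by_depsets E dep) X"
  then show "reachable E dep X"
  proof (induction rule: secured.induct)
    case empty
    have "rch E dep {} {}" by (simp add: rch_def)
    then show ?case unfolding reachable_def
      by (intro conjI exI[of _ 0] exI[of _ "\<lambda>_. {}"]) auto
  next
    case (insert X e)
    then obtain D where "D \<in> dep e" "D \<subseteq> X" by (auto simp: enabled_by_depsets_def)
    with insert show ?case by (intro reachable_insert)
  qed
qed

section \<open>The DSC of an antimatroid\<close>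

context antimatroid
begin

text \<open>
  In the language of antimatroids, the sets \<open>insert e D\<close> arising here are the paths with endpoint
  \<open>e\<close>, that is, the minimal feasible sets containing \<open>e\<close>: by \<open>feasible_before\<close>, a smaller feasible
  set containing \<open>e\<close> would give a smaller \<open>Y\<close> to which \<open>e\<close> can be added.
\<close>

definition path_depsets :: "'a \<Rightarrow> 'a set set" where
  "path_depsets e =
     {D \<in> F. e \<notin> D \<and> insert e D \<in> F \<and> (\<forall>Y\<in>F. insert e Y \<in> F \<longrightarrow> Y \<subseteq> D \<longrightarrow> Y = D)}"

lemma path_depset_below:
  assumes "Y \<in> F" "e \<notin> Y" "insert e Y \<in> F"
  shows "\<exists>D\<in>path_depsets e. D \<subseteq> Y"
proof -
  define S where "S = {D \<in> F. D \<subseteq> Y \<and> insert e D \<in> F}"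
  have "finite S" "Y \<in> S" using finite_family assms by (auto simp: S_def)
  from finite_has_minimal2[OF this]
  obtain D where D: "D \<in> S" and min: "\<And>Z. Z \<in> S \<Longrightarrow> Z \<subseteq> D \<Longrightarrow> D = Z"
    by blast
  have "Z = D" if "Z \<in> F" "insert e Z \<in> F" "Z \<subseteq> D" for Z
    using min[of Z] that D by (auto simp: S_def)
  then have "D \<in> path_depsets e"
    using D assms(2) unfolding path_depsets_def S_def by blast
  with D show ?thesis unfolding S_def by blast
qed

lemma complete_feasible:
  assumes "X \<in> F"
  shows "complete path_depsets X"
  unfolding complete_def
proof
  fix e assume "e \<in> X"
  then obtain Y where "Y \<in> F" "Y \<subseteq> X" "e \<notin> Y" "insert e Y \<in> F"
    using feasible_before[OF assms] by blast
  with path_depset_below[of Y e] show "\<exists>D\<in>path_depsets e. D \<subseteq> X"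
    by blast
qed

lemma DSC_path_depsets: "DSC (\<Union>F) path_depsets"
proof
  show "finite (\<Union>F)" by (rule finite_ground)
  fix e
  show "path_depsets e \<subseteq> Pow (\<Union>F)"
    unfolding path_depsets_def by blast
  show "path_depsets e \<noteq> {}" if "e \<in> \<Union>F"
    using complete_feasible that unfolding complete_def by blast
  fix D assume D: "D \<in> path_depsets e"
  then show "e \<notin> D"
    by (simp add: path_depsets_def)
  show "complete path_depsets D"
    using D by (intro complete_feasible) (simp add: path_depsets_def)
  show "D = D'" if "D' \<in> path_depsets e" "D \<subseteq> D'" for D'
    using D that by (simp add: path_depsets_def)
qed

lemma reachable_path_depsets: "reachable (\<Union>F) path_depsets X \<longleftrightarrow> X \<in> F"
proof -
  let ?en = "enabled_by_depsets (\<Union>F) path_depsets"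
  have "secured (\<Union>F) ?en X \<longleftrightarrow> X \<in> F"
  proof
    assume "secured (\<Union>F) ?en X"
    then show "X \<in> F"
    proof (induction rule: secured.induct)
      case (insert X e)
      then obtain D where "insert e D \<in> F" "D \<subseteq> X"
        by (auto simp: enabled_by_depsets_def path_depsets_def)
      then show ?case
        using Un_feasible[OF insert.IH, of "insert e D"] by (simp add: Un_absorb2)
    qed (rule empty_feasible)
  next
    assume "X \<in> F"
    then show "secured (\<Union>F) ?en X"
    proof (induction "card X" arbitrary: X rule: less_induct)
      case less
      show ?case
      proof (cases "X = {}")
        case False
        then obtain x where x: "x \<in> X" "X - {x} \<in> F"
          using accessible less.prems by blast
        have "card (X - {x}) < card X"
          using x(1) finite_feasible[OF less.prems] by (rule card_Diff1_less[rotated])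
        then have IH: "secured (\<Union>F) ?en (X - {x})" using less.hyps x(2) by blast
        have eq: "insert x (X - {x}) = X" using x(1) by blast
        then obtain D where "D \<in> path_depsets x" "D \<subseteq> X - {x}"
          using path_depset_below[of "X - {x}" x] x less.prems by auto
        then have "X - {x} \<in> ?en x"
          using less.prems by (auto simp: enabled_by_depsets_def)
        moreover have "x \<in> \<Union>F" using x(1) less.prems by blast
        ultimately show ?thesis using secured.insert[OF IH] eq by metis
      qed (simp add: secured.empty)
    qed
  qed
  then show ?thesis by (simp add: reachable_iff_secured[OF finite_ground])
qed

end

lemma order_isomorphic_refl: "order_isomorphic L L"
  unfolding order_isomorphic_def by (rule exI[of _ id]) simp

theorem (in CFES) diamond_free_semimodular_configurations:
  "diamond_free_semimodular_lattice (configuration_poset E en)"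
  using antimatroid.diamond_free_semimodular_lattice[OF antimatroid_secured]
  by (simp add: configuration_poset_def configuration_iff_secured)

theorem (in preDSC) rdp_isomorphic_DSC:
  "\<exists>(E' :: 'a set) dep'. DSC E' dep' \<and> order_isomorphic (rdp E dep) (rdp E' dep')"
proof -
  interpret R: CFES E "enabled_by_depsets E dep"
    by (rule CFES_enabled_by_depsets[OF finite_events])
  interpret antimatroid "{X. reachable E dep X}"
    using R.antimatroid_secured by (simp add: reachable_iff_secured[OF finite_events])
  have "rdp (\<Union>{X. reachable E dep X}) path_depsets = rdp E dep"
    by (simp only: rdp_def reachable_path_depsets Collect_mem_eq)
  then show ?thesis
    using DSC_path_depsets order_isomorphic_refl by metis
qed

theorem corollary5p15:
  shows "(\<forall>(E :: 'a set) en. CFES E en \<longrightarrow>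
            diamond_free_semimodular_lattice (configuration_poset E en)) \<and>
         (\<forall>(E :: 'b set) dep. preDSC E dep \<longrightarrow>
            (\<exists>(E' :: 'b set) dep'. DSC E' dep' \<and>
               order_isomorphic (rdp E dep) (rdp E' dep')))"
  using CFES.diamond_free_semimodular_configurations preDSC.rdp_isomorphic_DSC by blast

end
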